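(* Let $A\in\mathbb{R}^{n\times n}$ be symmetric positive definite with smallest and largest eigenvalues $\ell$ and $L$, let $b\in\mathbb{R}^n$, and let $f(x)=x^TAx/2-b^Tx$ with minimizer $x^*$. Let $x_k$ be the iterates of linear conjugate gradient (CG) applied to $f$ from an arbitrary $x_0$, and let $\tilde\sigma_k$ be the auxiliary scalars defined in the context from these iterates. Then for each $k=1,2,\ldots$, $$\tilde\sigma_k^2\le\left(1-\sqrt{\frac{\ell}{L}}\right)\tilde\sigma_{k-1}^2 .$$
   Context: Linear conjugate gradient (CG): $x_0$ is arbitrary; $r_0:=b-Ax_0$; $p_1:=r_0$; for $k=1,2,\ldots$: $\alpha_k:=\dfrac{r_{k-1}^Tr_{k-1}}{p_k^TAp_k}$; $x_k:=x_{k-1}+\alpha_kp_k$; $r_k:=r_{k-1}-\alpha_kAp_k$; $\beta_{k+1}:=\dfrac{r_k^Tr_k}{r_{k-1}^Tr_{k-1}}$; $p_{k+1}:=\beta_{k+1}p_k+r_k$. CG stops when the residual vanishes, so the index $k$ ranges over iterations that are performed (iteration $k\ge1$ requires $r_{k-1}\ne0$). Auxiliary quantities: $y_0:=x_0$, $\tilde\sigma_0:=\sqrt2\,\|\nabla f(x_0)\|/\ell$. For $k=1,2,\ldots$, let $\bar{\bar x}_{k-1}:=x_{k-1}-\nabla f(x_{k-1})/\ell$, $\tilde\rho_{k-1}:=\|\nabla f(x_{k-1})\|/\ell$, and $\gamma_j:=2(f(x_j)-f(x^* ))/\ell$ (so $\gamma_k-\gamma_{k-1}=2(f(x_k)-f(x_{k-1}))/\ell$).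 - If $\tilde\sigma_{k-1}^2\le2\tilde\rho_{k-1}^2$: let $\delta_{k-1}:=\|y_{k-1}-\bar{\bar x}_{k-1}\|$, $$\lambda_k:=\frac{\delta_{k-1}^2+\tilde\rho_{k-1}^2-\tilde\sigma_{k-1}^2}{2\delta_{k-1}^2},\qquad \tilde\xi_k^*:=\frac12\sqrt{2\tilde\rho_{k-1}^2+2\tilde\sigma_{k-1}^2-\delta_{k-1}^2-\frac{(\tilde\rho_{k-1}^2-\tilde\sigma_{k-1}^2)^2}{\delta_{k-1}^2}},$$ and $\tilde\sigma_k:=\sqrt{(\tilde\xi_k^* )^2-\gamma_{k-1}+\gamma_k}$. - Otherwise: $\lambda_k:=0$ and $\tilde\sigma_k:=\sqrt{\tilde\rho_{k-1}^2-\gamma_{k-1}+\gamma_k}$. In both cases $y_k:=(1-\lambda_k)\bar{\bar x}_{k-1}+\lambda_ky_{k-1}$. *)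

theory Defs
  imports "HOL-Analysis.Analysis"
begin

definition symmetric_pos_def :: "real^'n^'n \<Rightarrow> bool" where
  "symmetric_pos_def A \<longleftrightarrow> transpose A = A \<and> (\<forall>x. x \<noteq> 0 \<longrightarrow> x \<bullet> (A *v x) > 0)"

definition eigenvalues :: "real^'n^'n \<Rightarrow> real set" where
  "eigenvalues A = {c. \<exists>v. v \<noteq> 0 \<and> A *v v = c *\<^sub>R v}"

definition gradient :: "('a::real_inner \<Rightarrow> real) \<Rightarrow> 'a \<Rightarrow> 'a" where
  "gradient f x = (THE D. GDERIV f x :> D)"

definition quadratic :: "real^'n^'n \<Rightarrow> real^'n \<Rightarrow> real^'n \<Rightarrow> real" where
  "quadratic A b x = x \<bullet> (A *v x) / 2 - b \<bullet> x"

text \<open>The state after \<open>k\<close> iterations of linear CG is \<open>(x\<^sub>k, r\<^sub>k, p\<^sub>k\<^sub>+\<^sub>1)\<close>: the direction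
  component is one index ahead. The recursion is total, but it agrees with CG only as long as the
  residuals are nonzero; iteration \<open>k\<close> is performed iff \<open>r\<^sub>k\<^sub>-\<^sub>1 \<noteq> 0\<close>.\<close>

primrec cg_state ::
  "real^'n^'n \<Rightarrow> real^'n \<Rightarrow> real^'n \<Rightarrow> nat \<Rightarrow> (real^'n) \<times> (real^'n) \<times> (real^'n)" where
  "cg_state A b x0 0 = (x0, b - A *v x0, b - A *v x0)"
| "cg_state A b x0 (Suc k) =
    (let (x, r, p) = cg_state A b x0 k;
         \<alpha> = (r \<bullet> r) / (p \<bullet> (A *v p));
         x' = x + \<alpha> *\<^sub>R p;
         r' = r - \<alpha> *\<^sub>R (A *v p);
         \<beta> = (r' \<bullet> r') / (r \<bullet> r)
     in (x', r', \<beta> *\<^sub>R p + r'))"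

definition cg_iterate :: "real^'n^'n \<Rightarrow> real^'n \<Rightarrow> real^'n \<Rightarrow> nat \<Rightarrow> real^'n" where
  "cg_iterate A b x0 k = fst (cg_state A b x0 k)"

definition cg_residual :: "real^'n^'n \<Rightarrow> real^'n \<Rightarrow> real^'n \<Rightarrow> nat \<Rightarrow> real^'n" where
  "cg_residual A b x0 k = fst (snd (cg_state A b x0 k))"

text \<open>The pair \<open>(y\<^sub>k, \<sigma>\<^sub>k)\<close> computed from a sequence \<open>x\<close> of iterates for minimizing \<open>f\<close>, where
  \<open>l\<close> is the strong convexity modulus and \<open>xstar\<close> the minimizer.
  In the step, \<open>z\<close> is the long gradient step (the doubly barred \<open>x\<^sub>k\<^sub>-\<^sub>1\<close>).
  HOL's \<open>sqrt\<close> is total with \<open>sqrt (- t) = - sqrt t\<close>, and division by \<open>0\<close> gives \<open>0\<close>; for CG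
  iterates of a positive definite quadratic, as long as the residuals are nonzero, the radicands
  are nonnegative and \<open>\<delta>\<close> is positive whenever the first case applies.\<close>

primrec aux_state ::
  "('a::real_inner \<Rightarrow> real) \<Rightarrow> real \<Rightarrow> 'a \<Rightarrow> (nat \<Rightarrow> 'a) \<Rightarrow> nat \<Rightarrow> 'a \<times> real" where
  "aux_state f l xstar x 0 = (x 0, sqrt 2 * norm (gradient f (x 0)) / l)"
| "aux_state f l xstar x (Suc k) =
    (let (y, \<sigma>) = aux_state f l xstar x k;
         z = x k - (1 / l) *\<^sub>R gradient f (x k);
         \<rho> = norm (gradient f (x k)) / l;
         \<gamma> = (\<lambda>j. 2 * (f (x j) - f xstar) / l);
         \<delta> = norm (y - z);
         \<xi> = 1 / 2 * sqrt (2 * \<rho>\<^sup>2 + 2 * \<sigma>\<^sup>2 - \<delta>\<^sup>2 - (\<rho>\<^sup>2 - \<sigma>\<^sup>2)\<^sup>2 / \<delta>\<^sup>2);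
         (lam, \<sigma>') =
           (if \<sigma>\<^sup>2 \<le> 2 * \<rho>\<^sup>2
            then ((\<delta>\<^sup>2 + \<rho>\<^sup>2 - \<sigma>\<^sup>2) / (2 * \<delta>\<^sup>2), sqrt (\<xi>\<^sup>2 - \<gamma> k + \<gamma> (Suc k)))
            else (0, sqrt (\<rho>\<^sup>2 - \<gamma> k + \<gamma> (Suc k))))
     in ((1 - lam) *\<^sub>R z + lam *\<^sub>R y, \<sigma>'))"

definition aux_sigma ::
  "('a::real_inner \<Rightarrow> real) \<Rightarrow> real \<Rightarrow> 'a \<Rightarrow> (nat \<Rightarrow> 'a) \<Rightarrow> nat \<Rightarrow> real" where
  "aux_sigma f l xstar x k = snd (aux_state f l xstar x k)"

end

theory Submission
  imports Defs
begin

text \<open>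
  The pair \<open>(y\<^sub>k, \<sigma>\<^sub>k)\<close> encodes a ball containing the minimizer:
  \<open>\<parallel>xstar - y\<^sub>k\<parallel>\<^sup>2 \<le> \<sigma>\<^sub>k\<^sup>2 - \<gamma>\<^sub>k\<close>. Strong convexity gives a second such ball,
  \<open>\<parallel>xstar - z\<parallel>\<^sup>2 \<le> \<rho>\<^sup>2 - \<gamma>\<^sub>k\<close>, and the update encloses the intersection of the two.
  The CG residual \<open>r\<^sub>k\<close> is orthogonal to the Krylov space, which contains \<open>y\<^sub>k - x\<^sub>k\<close>; hence
  \<open>\<delta>\<^sup>2 = \<parallel>y\<^sub>k - x\<^sub>k\<parallel>\<^sup>2 + \<rho>\<^sup>2 \<ge> \<rho>\<^sup>2\<close>. In the first case this yields
  \<open>\<xi>\<^sup>2 \<le> \<sigma>\<^sup>2 - \<sigma>\<^sup>4 / (4 \<rho>\<^sup>2)\<close>. As CG decreases \<open>\<gamma>\<close> by at least \<open>(l / L) \<rho>\<^sup>2\<close>, the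
  arithmetic-geometric mean inequality
  \<open>\<sigma>\<^sup>4 / (4 \<rho>\<^sup>2) + (l / L) \<rho>\<^sup>2 \<ge> sqrt (l / L) \<sigma>\<^sup>2\<close> concludes.
\<close>

section \<open>Symmetric matrices: Rayleigh quotients and extreme eigenvalues\<close>

lemma symmetric_inner_matrix_vector:
  fixes A :: "real^'n^'n"
  assumes "transpose A = A"
  shows "u \<bullet> (A *v v) = (A *v u) \<bullet> v"
  by (metis assms dot_lmul_matrix transpose_matrix_vector)

lemma symmetric_quadratic_form_add:
  fixes A :: "real^'n^'n"
  assumes "transpose A = A"
  shows "(u + h) \<bullet> (A *v (u + h)) = u \<bullet> (A *v u) + 2 * (h \<bullet> (A *v u)) + h \<bullet> (A *v h)"
proof -
  have "u \<bullet> (A *v h) = h \<bullet> (A *v u)"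
    by (metis assms symmetric_inner_matrix_vector inner_commute)
  then show ?thesis
    by (simp add: matrix_vector_right_distrib inner_add_left inner_add_right)
qed

lemma matrix_vector_mult_uminus:
  fixes A :: "real^'n^'m"
  shows "(- A) *v v = - (A *v v)" "A *v (- v) = - (A *v v)"
  by (simp_all add: matrix_vector_mult_def vec_eq_iff sum_negf)

text \<open>Near \<open>t = 0\<close> the linear term dominates and changes sign with
  \<open>t\<close>, so it must vanish.\<close>

lemma linear_coefficient_zero:
  fixes a c :: real
  assumes "\<And>t. 0 \<le> t * a + t\<^sup>2 * c"
  shows "a = 0"
proof (rule ccontr)
  assume "a \<noteq> 0"
  \<comment> \<open>Exceeding both \<open>0\<close> and \<open>c\<close>, this \<open>d\<close>
    makes the value at \<open>t = - a / d\<close> negative.\<close>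
  define d where "d = \<bar>c\<bar> + 1"
  have d: "d > 0" "c < d" by (auto simp: d_def)
  have "0 \<le> (- a / d) * a + (- a / d)\<^sup>2 * c" by (rule assms)
  also have "\<dots> = (a\<^sup>2 / d\<^sup>2) * (c - d)"
    using d by (simp add: field_simps power2_eq_square)
  also have "\<dots> < 0"
    using d \<open>a \<noteq> 0\<close> by (intro mult_pos_neg) auto
  finally show False by simp
qed

text \<open>The quadratic form attains its minimum over the compact unit sphere, and first-order
  optimality makes the minimizer an eigenvector.\<close>

lemma smallest_eigenvalue_Rayleigh:
  fixes A :: "real^'n^'n"
  assumes sym: "transpose A = A"
  obtains m where "m \<in> eigenvalues A" "\<And>v. m * (v \<bullet> v) \<le> v \<bullet> (A *v v)"
proof -
  obtain e :: "real^'n" where e: "norm e = 1"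
    using vector_choose_size[of 1] by auto
  have "continuous_on (sphere 0 1) (\<lambda>v::real^'n. v \<bullet> (A *v v))"
    by (intro continuous_on_inner continuous_on_id linear_continuous_on
        matrix_vector_mul_bounded_linear)
  moreover have "sphere (0 :: real^'n) 1 \<noteq> {}" using e by (auto simp del: sphere_eq_empty)
  ultimately obtain u where "u \<in> sphere 0 1"
    and "\<And>v. v \<in> sphere 0 1 \<Longrightarrow> u \<bullet> (A *v u) \<le> v \<bullet> (A *v v)"
    using continuous_attains_inf[OF compact_sphere] by blast
  then have u: "norm u = 1"
    and min: "\<And>v. norm v = 1 \<Longrightarrow> u \<bullet> (A *v u) \<le> v \<bullet> (A *v v)"
    by simp_all
  define m where "m = u \<bullet> (A *v u)"
  have uu: "u \<bullet> u = 1" using u by (simp add: dot_square_norm)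
  have Rayleigh: "m * (v \<bullet> v) \<le> v \<bullet> (A *v v)" for v
  proof (cases "v = 0")
    case False
    let ?w = "(1 / norm v) *\<^sub>R v"
    have "m \<le> ?w \<bullet> (A *v ?w)"
      unfolding m_def by (rule min) (use False in simp)
    also have "\<dots> = v \<bullet> (A *v v) / (v \<bullet> v)"
      by (simp add: matrix_vector_mult_scaleR dot_square_norm power2_eq_square mult.assoc)
    finally show ?thesis using False by (simp add: pos_le_divide_eq)
  qed simp
  \<comment> \<open>The form \<open>v \<bullet> (A *v v) - m * (v \<bullet> v)\<close> is
    nonnegative and vanishes at \<open>u\<close>, so it has no linear term along any line
    \<open>u + t *\<^sub>R w\<close>.\<close>
  have "w \<bullet> (A *v u - m *\<^sub>R u) = 0" for w
  proof -
    have "0 \<le> t * (2 * (w \<bullet> (A *v u - m *\<^sub>R u))) + t\<^sup>2 * (w \<bullet> (A *v w) - m * (w \<bullet> w))" for t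
    proof -
      have form: "(u + t *\<^sub>R w) \<bullet> (A *v (u + t *\<^sub>R w))
          = m + 2 * (t * (w \<bullet> (A *v u))) + t\<^sup>2 * (w \<bullet> (A *v w))"
        unfolding symmetric_quadratic_form_add[OF sym] m_def
        by (simp add: matrix_vector_mult_scaleR power2_eq_square mult.assoc)
      have norm: "(u + t *\<^sub>R w) \<bullet> (u + t *\<^sub>R w) = 1 + 2 * (t * (w \<bullet> u)) + t\<^sup>2 * (w \<bullet> w)"
        by (simp add: inner_add_left inner_add_right uu inner_commute[of u w]
            power2_eq_square algebra_simps)
      have "0 \<le> (u + t *\<^sub>R w) \<bullet> (A *v (u + t *\<^sub>R w)) - m * ((u + t *\<^sub>R w) \<bullet> (u + t *\<^sub>R w))"
        using Rayleigh by simp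
      also have "\<dots> = t * (2 * (w \<bullet> (A *v u - m *\<^sub>R u))) + t\<^sup>2 * (w \<bullet> (A *v w) - m * (w \<bullet> w))"
        unfolding form norm by (simp add: inner_diff_right algebra_simps)
      finally show ?thesis .
    qed
    from linear_coefficient_zero[OF this] show ?thesis by simp
  qed
  from this[of "A *v u - m *\<^sub>R u"] have "A *v u = m *\<^sub>R u" by simp
  then have "m \<in> eigenvalues A"
    using u unfolding eigenvalues_def by (auto intro!: exI[of _ u])
  with Rayleigh show thesis by (rule that[rotated])
qed

lemma eigenvalues_uminus: "c \<in> eigenvalues (- A) \<longleftrightarrow> - c \<in> eigenvalues (A :: real^'n^'n)"
proof -
  have "(- A) *v v = c *\<^sub>R v \<longleftrightarrow> A *v v = (- c) *\<^sub>R v" for v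
    unfolding matrix_vector_mult_uminus scaleR_minus_left by (metis minus_minus)
  then show ?thesis by (auto simp: eigenvalues_def)
qed

text \<open>The Rayleigh minimum is itself an eigenvalue, hence at least \<open>l\<close>. The upper
  bound is the same argument for \<open>- A\<close>.\<close>

lemma eigenvalue_bounds:
  fixes A :: "real^'n^'n"
  assumes sym: "transpose A = A"
    and l: "\<forall>c\<in>eigenvalues A. l \<le> c" and L: "\<forall>c\<in>eigenvalues A. c \<le> L"
  shows "l * (v \<bullet> v) \<le> v \<bullet> (A *v v)" "v \<bullet> (A *v v) \<le> L * (v \<bullet> v)"
proof -
  obtain m where m: "m \<in> eigenvalues A" "\<And>v. m * (v \<bullet> v) \<le> v \<bullet> (A *v v)"
    using smallest_eigenvalue_Rayleigh[OF sym] by blast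
  show "l * (v \<bullet> v) \<le> v \<bullet> (A *v v)"
    using m l by (meson inner_ge_zero mult_right_mono order_trans)
  have "transpose (- A) = - A" using sym by (simp add: transpose_def vec_eq_iff)
  then obtain m' where m': "m' \<in> eigenvalues (- A)"
    and R: "\<And>v. m' * (v \<bullet> v) \<le> v \<bullet> ((- A) *v v)"
    using smallest_eigenvalue_Rayleigh by blast
  have "v \<bullet> (A *v v) \<le> - m' * (v \<bullet> v)"
    using R[of v] by (simp add: matrix_vector_mult_uminus)
  also have "\<dots> \<le> L * (v \<bullet> v)"
    using m' L by (intro mult_right_mono) (auto simp: eigenvalues_uminus)
  finally show "v \<bullet> (A *v v) \<le> L * (v \<bullet> v)" .
qed

section \<open>The quadratic objective and its gradient\<close>

lemma quadratic_add:
  fixes A :: "real^'n^'n"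
  assumes "transpose A = A"
  shows "quadratic A b (x + h) = quadratic A b x + (A *v x - b) \<bullet> h + h \<bullet> (A *v h) / 2"
  unfolding quadratic_def symmetric_quadratic_form_add[OF assms]
  by (simp add: inner_simps inner_commute field_simps)

lemma gradient_quadratic:
  fixes A :: "real^'n^'n"
  assumes sym: "transpose A = A"
  shows "gradient (quadratic A b) x = A *v x - b"
proof -
  have "((\<lambda>x. x \<bullet> (A *v x) / 2 - b \<bullet> x) has_derivative
      (\<lambda>h. (x \<bullet> (A *v h) + h \<bullet> (A *v x)) / 2 - b \<bullet> h)) (at x)"
    by (intro has_derivative_diff bounded_linear.has_derivative[OF bounded_linear_divide]
        has_derivative_inner has_derivative_ident
        bounded_linear_imp_has_derivative matrix_vector_mul_bounded_linear bounded_linear_inner_right)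
  moreover have "(x \<bullet> (A *v h) + h \<bullet> (A *v x)) / 2 - b \<bullet> h = h \<bullet> (A *v x - b)" for h
    using symmetric_inner_matrix_vector[OF sym, of x h] by (simp add: inner_simps inner_commute)
  ultimately have "GDERIV (quadratic A b) x :> A *v x - b"
    by (simp add: gderiv_def quadratic_def[abs_def])
  \<comment> \<open>\<open>gradient\<close> is a definite description, so uniqueness of the
    derivative is needed as well.\<close>
  moreover have "D = A *v x - b" if "GDERIV (quadratic A b) x :> D" for D
  proof -
    have "(\<lambda>h. h \<bullet> D) = (\<lambda>h. h \<bullet> (A *v x - b))"
      using that calculation has_derivative_unique unfolding gderiv_def by blast
    then have "(D - (A *v x - b)) \<bullet> (D - (A *v x - b)) = 0"
      unfolding inner_diff_right[of _ D] by (simp add: fun_eq_iff)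
    then show ?thesis by simp
  qed
  ultimately show ?thesis unfolding gradient_def by (rule the_equality)
qed

section \<open>Enclosing the intersection of two balls\<close>

text \<open>Holds for negative \<open>t\<close> too, because \<open>sqrt\<close> is odd. The radii
  can thus be unfolded before their radicands are known to be nonnegative.\<close>

lemma power2_sqrt_eq_abs: "(sqrt t)\<^sup>2 = \<bar>t\<bar>"
  by (metis real_sqrt_abs real_sqrt_power)

text \<open>Stewart's identity, valid for every real \<open>t\<close>.\<close>

lemma power2_norm_affine_combination:
  fixes v y z :: "'a::real_inner"
  shows "(norm (v - ((1 - t) *\<^sub>R z + t *\<^sub>R y)))\<^sup>2
    = t * (norm (v - y))\<^sup>2 + (1 - t) * (norm (v - z))\<^sup>2 - t * (1 - t) * (norm (y - z))\<^sup>2"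
  unfolding power2_norm_eq_inner
  by (simp add: inner_simps inner_commute[of z v] inner_commute[of y v] inner_commute[of z y]
      algebra_simps)

text \<open>The two ball inequalities are averaged with weights \<open>1 - t\<close> and
  \<open>t\<close>; this \<open>t\<close> minimizes the resulting quadratic bound on the squared
  distance.\<close>

lemma ball_intersection_enclosed:
  fixes v y z :: "'a::real_inner" and q s g :: real
  defines "D \<equiv> (norm (y - z))\<^sup>2"
  defines "t \<equiv> (D + q - s) / (2 * D)"
  assumes D: "0 < D" "\<bar>q - s\<bar> \<le> D"
    and z: "(norm (v - z))\<^sup>2 \<le> q - g" and y: "(norm (v - y))\<^sup>2 \<le> s - g"
  shows "(norm (v - ((1 - t) *\<^sub>R z + t *\<^sub>R y)))\<^sup>2 \<le> (2 * q + 2 * s - D - (q - s)\<^sup>2 / D) / 4 - g"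
proof -
  \<comment> \<open>The hypothesis \<open>\<bar>q - s\<bar> \<le> D\<close> says exactly that both
    weights are nonnegative.\<close>
  have t: "0 \<le> t" "t \<le> 1" using D by (auto simp: t_def field_simps)
  have tD: "t * D = (D + q - s) / 2" using D by (simp add: t_def)
  have "(norm (v - ((1 - t) *\<^sub>R z + t *\<^sub>R y)))\<^sup>2 \<le> t * (s - g) + (1 - t) * (q - g) - t * (1 - t) * D"
    unfolding power2_norm_affine_combination D_def[symmetric]
    using t y z by (intro diff_right_mono add_mono mult_left_mono) auto
  also have "\<dots> = q - g - t * (D + q - s) + t * (t * D)"
    by (simp add: algebra_simps)
  also have "\<dots> = q - g - (D + q - s)\<^sup>2 / (4 * D)"
    unfolding tD by (simp add: t_def power2_eq_square)
  also have "\<dots> = (2 * q + 2 * s - D - (q - s)\<^sup>2 / D) / 4 - g"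
    using D(1) by (simp add: field_simps power2_eq_square)
  finally show ?thesis .
qed

text \<open>To be used with \<open>q\<close> = \<rho> squared, \<open>s\<close> = \<sigma> squared,
  \<open>D\<close> = \<delta> squared and \<open>e = l / L\<close>. The worst case is
  \<open>D = q\<close>, where the radius term becomes
  \<open>s - s\<^sup>2 / (4 * q)\<close>.\<close>

lemma enclosing_radius_contraction:
  fixes q s D e :: real
  assumes q: "0 < q" "q \<le> D" and s: "0 \<le> s" "s \<le> 2 * q" and "0 \<le> e"
  shows "(2 * q + 2 * s - D - (q - s)\<^sup>2 / D) / 4 - e * q \<le> (1 - sqrt e) * s"
proof -
  have "(q - s)\<^sup>2 \<le> q\<^sup>2" using s q by (simp add: abs_le_square_iff[symmetric])
  also have "\<dots> \<le> q * D" using q by (simp add: power2_eq_square)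
  finally have "(q - s)\<^sup>2 * (D - q) \<le> q * D * (D - q)"
    using q by (intro mult_right_mono) auto
  \<comment> \<open>The map sending \<open>D\<close> to \<open>D + (q - s)\<^sup>2 / D\<close> is
    compared with its value at \<open>q\<close>: the difference has the sign of
    \<open>(D - q) * (q * D - (q - s)\<^sup>2)\<close>.\<close>
  then have D: "q + (q - s)\<^sup>2 / q \<le> D + (q - s)\<^sup>2 / D"
    using q by (simp add: field_simps)
  have "0 \<le> (s - 2 * sqrt e * q)\<^sup>2 / (4 * q)" using q by simp
  also have "\<dots> = s\<^sup>2 / (4 * q) - sqrt e * s + (sqrt e)\<^sup>2 * q"
    using q by (simp add: field_simps power2_eq_square)
  finally have "sqrt e * s \<le> s\<^sup>2 / (4 * q) + e * q" using \<open>0 \<le> e\<close> by simp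
  moreover have "(2 * q + 2 * s - D - (q - s)\<^sup>2 / D) / 4 \<le> (2 * q + 2 * s - (q + (q - s)\<^sup>2 / q)) / 4"
    using D by (intro divide_right_mono) auto
  moreover have "(2 * q + 2 * s - (q + (q - s)\<^sup>2 / q)) / 4 = s - s\<^sup>2 / (4 * q)"
    using q by (simp add: field_simps power2_eq_square)
  ultimately show ?thesis by (simp only: left_diff_distrib mult_1_left)
qed

section \<open>Conjugate gradients: Krylov spaces and orthogonality\<close>

text \<open>\<open>cg_direction A b x0 k\<close> is the paper's \<open>p\<^sub>k\<^sub>+\<^sub>1\<close>.\<close>

definition cg_direction :: "real^'n^'n \<Rightarrow> real^'n \<Rightarrow> real^'n \<Rightarrow> nat \<Rightarrow> real^'n" where
  "cg_direction A b x0 k = snd (snd (cg_state A b x0 k))"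

definition aux_center ::
  "('a::real_inner \<Rightarrow> real) \<Rightarrow> real \<Rightarrow> 'a \<Rightarrow> (nat \<Rightarrow> 'a) \<Rightarrow> nat \<Rightarrow> 'a" where
  "aux_center f l xstar x k = fst (aux_state f l xstar x k)"

text \<open>Eigenvalues enter only through the Rayleigh bounds \<open>lower\<close> and
  \<open>upper\<close>. Nonvanishing of residuals is assumed lemma by lemma, since the recursion is
  total.\<close>

locale cg_run =
  fixes A :: "real^'n^'n" and b x0 xstar :: "real^'n" and l L :: real
  assumes sym: "transpose A = A"
    and lower: "\<And>v. l * (v \<bullet> v) \<le> v \<bullet> (A *v v)"
    and upper: "\<And>v. v \<bullet> (A *v v) \<le> L * (v \<bullet> v)"
    and l_pos: "0 < l" and l_le_L: "l \<le> L"
    and minimizer: "\<And>v. quadratic A b xstar \<le> quadratic A b v"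
begin

abbreviation "f \<equiv> quadratic A b"
abbreviation "x \<equiv> cg_iterate A b x0"
abbreviation "r \<equiv> cg_residual A b x0"
abbreviation "p \<equiv> cg_direction A b x0"
abbreviation "y \<equiv> aux_center f l xstar x"
abbreviation "\<sigma> \<equiv> aux_sigma f l xstar x"
abbreviation "\<gamma> k \<equiv> 2 * (f (x k) - f xstar) / l"
abbreviation "\<rho> k \<equiv> norm (r k) / l"
abbreviation "\<alpha> k \<equiv> (r k \<bullet> r k) / (p k \<bullet> (A *v p k))"
abbreviation "\<beta> k \<equiv> (r (Suc k) \<bullet> r (Suc k)) / (r k \<bullet> r k)"
text \<open>Spanned by directions, so that orthogonality to the whole space reduces to orthogonality
  to each \<open>p j\<close>.\<close>

abbreviation "K k \<equiv> span (p ` {..<k})"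

lemmas A_simps = matrix_vector_mult_scaleR matrix_vector_right_distrib
  matrix_vector_mult_diff_distrib matrix_vector_mult_uminus

lemma L_pos: "0 < L"
  using l_pos l_le_L by linarith

lemma A_pos: "v \<noteq> 0 \<Longrightarrow> 0 < v \<bullet> (A *v v)"
  using lower[of v] l_pos by (smt (verit) inner_gt_zero_iff mult_pos_pos)

lemma cg_0: "x 0 = x0" "r 0 = b - A *v x0" "p 0 = r 0"
  by (simp_all add: cg_iterate_def cg_residual_def cg_direction_def)

lemma cg_Suc:
  "x (Suc k) = x k + \<alpha> k *\<^sub>R p k"
  "r (Suc k) = r k - \<alpha> k *\<^sub>R (A *v p k)"
  "p (Suc k) = \<beta> k *\<^sub>R p k + r (Suc k)"
  by (simp_all add: cg_iterate_def cg_residual_def cg_direction_def Let_def split: prod.split)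

lemma residual_eq: "r k = b - A *v x k"
  by (induction k) (simp_all add: cg_0 cg_Suc A_simps)

lemma gradient_iterate: "gradient f (x k) = - r k"
  by (simp add: gradient_quadratic[OF sym] residual_eq)

text \<open>Once \<open>r k = 0\<close>, the step length \<open>\<alpha> k\<close> is
  \<open>0\<close> and the residual stays zero.\<close>

lemma residual_nonzero_antimono: "r k \<noteq> 0 \<Longrightarrow> j \<le> k \<Longrightarrow> r j \<noteq> 0"
proof (induction k)
  case (Suc k)
  have "r k \<noteq> 0" using Suc.prems(1) cg_Suc(2)[of k] by auto
  then show ?case using Suc by (metis le_Suc_eq)
qed simp

lemma K_mono: "j \<le> k \<Longrightarrow> K j \<subseteq> K k"
  by (intro span_mono image_mono) auto

lemma direction_in_K: "j < k \<Longrightarrow> p j \<in> K k"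
  by (intro span_base) auto

lemma residual_in_K:
  assumes "j < k"
  shows "r j \<in> K k"
proof (cases j)
  case 0
  then show ?thesis using assms direction_in_K[of 0 k] by (simp add: cg_0)
next
  case (Suc i)
  have "p (Suc i) - \<beta> i *\<^sub>R p i \<in> K k"
    using assms Suc by (intro span_diff span_scale direction_in_K) auto
  then show ?thesis using Suc by (simp add: cg_Suc(3))
qed

lemma orthogonal_K:
  assumes "\<And>j. j < k \<Longrightarrow> u \<bullet> p j = 0" "v \<in> K k"
  shows "u \<bullet> v = 0"
  using assms(2)
proof (induction rule: span_induct)
  case base
  show ?case by (auto simp: subspace_def inner_simps)
qed (use assms(1) in auto)

text \<open>The three claims are proved jointly: orthogonality of \<open>r\<close> to the directions
  uses conjugacy and the third claim, conjugacy uses orthogonality of residuals, and the third claim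
  keeps directions nonzero.\<close>

lemma cg_orthogonality:
  assumes "\<And>j. j < k \<Longrightarrow> r j \<noteq> 0"
  shows "(\<forall>j<k. r k \<bullet> p j = 0) \<and> (\<forall>j<k. p k \<bullet> (A *v p j) = 0) \<and> (\<forall>j\<le>k. r j \<bullet> p j = r j \<bullet> r j)"
  using assms
proof (induction k)
  case (Suc k)
  have IH: "\<And>j. j < k \<Longrightarrow> r k \<bullet> p j = 0" "\<And>j. j < k \<Longrightarrow> p k \<bullet> (A *v p j) = 0"
    "\<And>j. j \<le> k \<Longrightarrow> r j \<bullet> p j = r j \<bullet> r j"
    using Suc by auto
  have rk: "r k \<noteq> 0" using Suc.prems by simp
  \<comment> \<open>\<open>r j \<bullet> p j = r j \<bullet> r j\<close> is nonzero, so
    \<open>p j\<close> is nonzero and \<open>\<alpha> j\<close> is a genuine quotient.\<close>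
  have pAp: "0 < p j \<bullet> (A *v p j)" if "j \<le> k" for j
    using IH(3)[OF that] Suc.prems[of j] that by (intro A_pos) auto
  have ortho_p: "r (Suc k) \<bullet> p j = 0" if "j < Suc k" for j
  proof (cases "j = k")
    case True
    then show ?thesis using IH(3)[of k] pAp[of k] by (simp add: cg_Suc(2) inner_simps inner_commute)
  next
    case False
    then show ?thesis using that IH symmetric_inner_matrix_vector[OF sym, of "p k" "p j"]
      by (simp add: cg_Suc(2) inner_simps)
  qed
  have ortho_r: "r (Suc k) \<bullet> r j = 0" if "j < Suc k" for j
    using orthogonal_K[OF ortho_p residual_in_K] that by blast
  have "p (Suc k) \<bullet> (A *v p j) = 0" if "j < Suc k" for j
  proof (cases "j = k")
    case True
    \<comment> \<open>\<open>A *v p k\<close> is a multiple of a difference of residuals;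
      \<open>\<beta> k\<close> is the coefficient that cancels its product with
      \<open>r (Suc k)\<close>.\<close>
    have "\<alpha> k * (r (Suc k) \<bullet> (A *v p k)) = r (Suc k) \<bullet> (r k - r (Suc k))"
      by (simp add: cg_Suc(2)[of k] inner_simps)
    also have "\<dots> = - (r (Suc k) \<bullet> r (Suc k))"
      using ortho_r[of k] by (simp add: inner_simps)
    finally have "r (Suc k) \<bullet> (A *v p k) = - \<beta> k * (p k \<bullet> (A *v p k))"
      using pAp[of k] rk by (simp add: field_simps)
    then show ?thesis using True by (simp add: cg_Suc(3) inner_simps)
  next
    case False
    then have j: "j < k" using that by simp
    have "r j \<bullet> r j \<noteq> 0" using Suc.prems that by simp
    \<comment> \<open>Here both residuals in the difference have index at most \<open>k\<close>, so
      both are orthogonal to \<open>r (Suc k)\<close>.\<close>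
    have "\<alpha> j * (r (Suc k) \<bullet> (A *v p j)) = r (Suc k) \<bullet> (r j - r (Suc j))"
      by (simp add: cg_Suc(2)[of j] inner_simps)
    also have "\<dots> = 0"
      using ortho_r j by (simp add: inner_simps)
    finally have "r (Suc k) \<bullet> (A *v p j) = 0"
      using \<open>r j \<bullet> r j \<noteq> 0\<close> pAp[of j] j by simp
    then show ?thesis using IH(2) j by (simp add: cg_Suc(3) inner_simps)
  qed
  moreover have "r (Suc k) \<bullet> p (Suc k) = r (Suc k) \<bullet> r (Suc k)"
    using ortho_p[of k] by (simp add: cg_Suc(3) inner_simps)
  ultimately show ?case using ortho_p IH(3) by (auto simp: le_Suc_eq)
qed (simp add: cg_0)

lemma residual_orthogonal_K:
  assumes "\<And>j. j < k \<Longrightarrow> r j \<noteq> 0" "v \<in> K k"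
  shows "r k \<bullet> v = 0"
  using cg_orthogonality[OF assms(1)] assms(2) by (blast intro: orthogonal_K)

lemma iterate_in_K: "x k - x0 \<in> K k"
proof (induction k)
  case (Suc k)
  have "x k - x0 \<in> K (Suc k)" using Suc K_mono[of k "Suc k"] by auto
  then have "(x k - x0) + \<alpha> k *\<^sub>R p k \<in> K (Suc k)"
    by (intro span_add span_scale direction_in_K) auto
  then show ?case by (simp add: cg_Suc(1) algebra_simps)
qed (simp add: cg_0)

section \<open>Decrease of the objective and balls containing the minimizer\<close>

text \<open>The step length \<open>1 / L\<close> minimizes the quadratic upper model of
  \<open>f\<close> along the gradient that \<open>upper\<close> provides.\<close>

lemma gradient_step_decrease:
  "f (v - (1 / L) *\<^sub>R (A *v v - b)) \<le> f v - (norm (A *v v - b))\<^sup>2 / (2 * L)"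
proof -
  define g where "g = A *v v - b"
  have "f (v - (1 / L) *\<^sub>R g) = f v - (g \<bullet> g) / L + (g \<bullet> (A *v g)) / (2 * L\<^sup>2)"
    using quadratic_add[OF sym, of b v "- (1 / L) *\<^sub>R g"]
    by (simp add: A_simps power2_eq_square g_def[symmetric])
  also have "\<dots> \<le> f v - (g \<bullet> g) / L + (L * (g \<bullet> g)) / (2 * L\<^sup>2)"
    using upper[of g] by (intro add_left_mono divide_right_mono) auto
  also have "\<dots> = f v - (norm g)\<^sup>2 / (2 * L)"
    using L_pos by (simp add: dot_square_norm power2_eq_square field_simps)
  finally show ?thesis unfolding g_def .
qed

text \<open>A nonzero gradient at \<open>xstar\<close> would let a gradient step go below the
  minimum.\<close>

lemma minimizer_stationary: "A *v xstar = b"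
proof -
  have "f xstar \<le> f xstar - (norm (A *v xstar - b))\<^sup>2 / (2 * L)"
    using minimizer gradient_step_decrease order_trans by blast
  then have "(norm (A *v xstar - b))\<^sup>2 \<le> 0" using L_pos by (simp add: divide_le_0_iff)
  then show ?thesis by simp
qed

text \<open>\<open>x (Suc k)\<close> minimizes \<open>f\<close> over \<open>x0 + K (Suc k)\<close>,
  and this affine space contains the gradient step \<open>?u\<close> from
  \<open>x k\<close>.\<close>

lemma cg_decrease:
  assumes "\<And>j. j \<le> k \<Longrightarrow> r j \<noteq> 0"
  shows "\<gamma> (Suc k) - \<gamma> k \<le> - (l / L) * (\<rho> k)\<^sup>2"
proof -
  let ?u = "x k + (1 / L) *\<^sub>R r k"
  have "x k - x0 \<in> K (Suc k)" using iterate_in_K[of k] K_mono[of k "Suc k"] by auto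
  then have "(x k - x0) + (1 / L) *\<^sub>R r k - (x (Suc k) - x0) \<in> K (Suc k)"
    by (rule span_diff[OF span_add[OF _ span_scale[OF residual_in_K]] iterate_in_K]) simp
  then have "?u - x (Suc k) \<in> K (Suc k)" by (simp add: algebra_simps)
  then have "r (Suc k) \<bullet> (?u - x (Suc k)) = 0"
    using assms by (intro residual_orthogonal_K) auto
  moreover have "A *v x (Suc k) - b = - r (Suc k)" by (simp add: residual_eq)
  \<comment> \<open>In the expansion at \<open>x (Suc k)\<close> the linear term vanishes by
    orthogonality and the quadratic term is nonnegative.\<close>
  ultimately have "f (x (Suc k)) \<le> f ?u"
    using quadratic_add[OF sym, of b "x (Suc k)" "?u - x (Suc k)"] A_pos[of "?u - x (Suc k)"]
    by (cases "?u = x (Suc k)") auto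
  also have "\<dots> \<le> f (x k) - (norm (r k))\<^sup>2 / (2 * L)"
    using gradient_step_decrease[of "x k"]
    by (simp add: residual_eq norm_minus_commute algebra_simps)
  finally have "f (x (Suc k)) - f (x k) \<le> - ((norm (r k))\<^sup>2 / (2 * L))" by simp
  then have "(2 / l) * (f (x (Suc k)) - f (x k)) \<le> (2 / l) * - ((norm (r k))\<^sup>2 / (2 * L))"
    using l_pos by (intro mult_left_mono) auto
  then show ?thesis using l_pos L_pos
    by (simp add: field_simps power2_eq_square)
qed

lemma gamma_nonneg: "0 \<le> \<gamma> k"
  using minimizer l_pos by simp

text \<open>Expand \<open>f xstar\<close> around \<open>x k\<close>, bound the quadratic term by
  \<open>lower\<close>, and complete the square.\<close>

lemma long_step_ball: "(norm (xstar - (x k + (1 / l) *\<^sub>R r k)))\<^sup>2 \<le> (\<rho> k)\<^sup>2 - \<gamma> k"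
proof -
  let ?d = "xstar - x k"
  have "f xstar = f (x k) - r k \<bullet> ?d + ?d \<bullet> (A *v ?d) / 2"
    using quadratic_add[OF sym, of b "x k" ?d] by (simp add: residual_eq inner_simps)
  then have "l * (?d \<bullet> ?d) \<le> 2 * (f xstar - f (x k)) + 2 * (r k \<bullet> ?d)"
    using lower[of ?d] by simp
  then have "?d \<bullet> ?d \<le> 2 * (r k \<bullet> ?d) / l - \<gamma> k"
    using l_pos by (simp add: field_simps)
  moreover have "(norm (xstar - (x k + (1 / l) *\<^sub>R r k)))\<^sup>2
      = ?d \<bullet> ?d - 2 * (r k \<bullet> ?d) / l + (\<rho> k)\<^sup>2"
  proof -
    have "(norm (d - (1 / l) *\<^sub>R u))\<^sup>2 = d \<bullet> d - 2 * (u \<bullet> d) / l + (norm u / l)\<^sup>2"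
      for d u :: "real^'n"
      unfolding power_divide power2_norm_eq_inner
      by (simp add: inner_simps inner_commute power2_eq_square diff_divide_distrib)
    from this[of ?d "r k"] show ?thesis by (simp add: diff_diff_eq)
  qed
  ultimately show ?thesis by linarith
qed

text \<open>Base case of the ball invariant. The factor 2 is the sum of two bounds by the square of
  \<open>\<rho> 0\<close>: one for the squared distance, one for \<open>\<gamma> 0\<close>.\<close>

lemma initial_ball: "(norm (xstar - x 0))\<^sup>2 \<le> 2 * (\<rho> 0)\<^sup>2 - \<gamma> 0"
proof -
  let ?d = "xstar - x 0"
  have g: "r 0 = A *v ?d"
    by (simp add: residual_eq minimizer_stationary A_simps)
  have f: "f (x 0) - f xstar = r 0 \<bullet> ?d / 2"
    using quadratic_add[OF sym, of b xstar "- ?d"] minimizer_stationary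
    by (simp add: g A_simps inner_simps inner_commute)
  have le: "r 0 \<bullet> ?d \<le> norm (r 0) * norm ?d" by (rule norm_cauchy_schwarz)
  have "l * (norm ?d)\<^sup>2 \<le> norm (r 0) * norm ?d"
    using lower[of ?d] le g by (simp add: dot_square_norm inner_commute)
  then have d: "norm ?d \<le> \<rho> 0"
    using l_pos by (cases "?d = 0") (auto simp: field_simps power2_eq_square)
  have "\<gamma> 0 = (r 0 \<bullet> ?d) / l" using f by simp
  also have "\<dots> \<le> \<rho> 0 * norm ?d" using le l_pos by (simp add: field_simps)
  also have "\<dots> \<le> \<rho> 0 * \<rho> 0" using d l_pos by (intro mult_left_mono) auto
  finally have "\<gamma> 0 \<le> (\<rho> 0)\<^sup>2" by (simp add: power2_eq_square)
  moreover have "(norm ?d)\<^sup>2 \<le> (\<rho> 0)\<^sup>2" using d by (intro power_mono) auto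
  ultimately show ?thesis by linarith
qed

section \<open>The auxiliary centers and radii\<close>

abbreviation "z k \<equiv> x k + (1 / l) *\<^sub>R r k"
abbreviation "\<delta> k \<equiv> norm (y k - z k)"

lemma aux_0: "y 0 = x0" "(\<sigma> 0)\<^sup>2 = 2 * (\<rho> 0)\<^sup>2"
  by (simp_all add: aux_center_def aux_sigma_def cg_0(1)
      gradient_iterate[of 0, unfolded cg_0(1)] power_mult_distrib power_divide)

text \<open>The two absolute values come from squaring the nested roots of \<xi> and \<sigma>;
  \<open>aux_step\<close> removes them.\<close>

lemma aux_Suc_near:
  assumes "(\<sigma> k)\<^sup>2 \<le> 2 * (\<rho> k)\<^sup>2"
  defines "t \<equiv> ((\<delta> k)\<^sup>2 + (\<rho> k)\<^sup>2 - (\<sigma> k)\<^sup>2) / (2 * (\<delta> k)\<^sup>2)"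
  shows "y (Suc k) = (1 - t) *\<^sub>R z k + t *\<^sub>R y k"
    "(\<sigma> (Suc k))\<^sup>2 = \<bar>\<bar>2 * (\<rho> k)\<^sup>2 + 2 * (\<sigma> k)\<^sup>2 - (\<delta> k)\<^sup>2
        - ((\<rho> k)\<^sup>2 - (\<sigma> k)\<^sup>2)\<^sup>2 / (\<delta> k)\<^sup>2\<bar> / 4 - \<gamma> k + \<gamma> (Suc k)\<bar>"
  using assms(1) unfolding t_def aux_center_def aux_sigma_def
  by (simp_all add: case_prod_beta Let_def gradient_iterate power2_sqrt_eq_abs
      power_divide[of "sqrt _" 2])

lemma aux_Suc_far:
  assumes "\<not> (\<sigma> k)\<^sup>2 \<le> 2 * (\<rho> k)\<^sup>2"
  shows "y (Suc k) = z k" "(\<sigma> (Suc k))\<^sup>2 = \<bar>(\<rho> k)\<^sup>2 - \<gamma> k + \<gamma> (Suc k)\<bar>"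
  using assms unfolding aux_center_def aux_sigma_def
  by (simp_all add: case_prod_beta Let_def gradient_iterate power2_sqrt_eq_abs)

text \<open>Each new center is an affine combination of \<open>z k\<close> and \<open>y k\<close>,
  both in \<open>x0 + K (Suc k)\<close>.\<close>

lemma aux_center_in_K: "y k - x0 \<in> K k"
proof (induction k)
  case (Suc k)
  have K: "K k \<subseteq> K (Suc k)" by (rule K_mono) simp
  have "(x k - x0) + (1 / l) *\<^sub>R r k \<in> K (Suc k)"
    using iterate_in_K[of k] K by (intro span_add span_scale residual_in_K) auto
  then have z: "z k - x0 \<in> K (Suc k)" by (simp add: algebra_simps)
  have "(1 - t) *\<^sub>R (z k - x0) + t *\<^sub>R (y k - x0) \<in> K (Suc k)" for t
    using z Suc K by (intro span_add span_scale) auto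
  moreover have "(1 - t) *\<^sub>R (z k - x0) + t *\<^sub>R (y k - x0) = (1 - t) *\<^sub>R z k + t *\<^sub>R y k - x0" for t
    by (simp add: algebra_simps)
  ultimately have "(1 - t) *\<^sub>R z k + t *\<^sub>R y k - x0 \<in> K (Suc k)" for t by metis
  then show ?case
    using z aux_Suc_near(1)[of k] aux_Suc_far(1)[of k]
    by (cases "(\<sigma> k)\<^sup>2 \<le> 2 * (\<rho> k)\<^sup>2") simp_all
qed (simp add: aux_0)

text \<open>Pythagoras: \<open>y k - z k\<close> splits into \<open>y k - x k\<close> and a multiple
  of \<open>r k\<close>, which are orthogonal.\<close>

lemma long_step_le_delta:
  assumes "\<And>j. j < k \<Longrightarrow> r j \<noteq> 0"
  shows "(\<rho> k)\<^sup>2 \<le> (\<delta> k)\<^sup>2"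
proof -
  have "(y k - x0) - (x k - x0) \<in> K k"
    by (intro span_diff[OF aux_center_in_K iterate_in_K])
  then have "r k \<bullet> (y k - x k) = 0"
    using assms by (intro residual_orthogonal_K) auto
  moreover have "(norm (w - (1 / l) *\<^sub>R u))\<^sup>2 = (norm w)\<^sup>2 + (norm u / l)\<^sup>2"
    if "u \<bullet> w = 0" for u w :: "real^'n"
    using that unfolding power_divide power2_norm_eq_inner
    by (simp add: inner_diff_left inner_diff_right inner_commute power2_eq_square)
  ultimately have "(norm (y k - x k - (1 / l) *\<^sub>R r k))\<^sup>2 = (norm (y k - x k))\<^sup>2 + (\<rho> k)\<^sup>2"
    by blast
  then show ?thesis by (simp add: diff_diff_eq)
qed

text \<open>Both claims rest on the value of the new squared radius, whose radicands are nonnegative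
  because the enclosing ball contains \<open>xstar\<close>.\<close>

lemma aux_step:
  assumes r: "\<And>j. j \<le> k \<Longrightarrow> r j \<noteq> 0"
    and ball: "(norm (xstar - y k))\<^sup>2 \<le> (\<sigma> k)\<^sup>2 - \<gamma> k"
  shows "(norm (xstar - y (Suc k)))\<^sup>2 \<le> (\<sigma> (Suc k))\<^sup>2 - \<gamma> (Suc k)"
    and "(\<sigma> (Suc k))\<^sup>2 \<le> (1 - sqrt (l / L)) * (\<sigma> k)\<^sup>2"
proof -
  have \<rho>: "0 < (\<rho> k)\<^sup>2" using r[of k] l_pos by simp
  have dec: "\<gamma> (Suc k) - \<gamma> k \<le> - (l / L) * (\<rho> k)\<^sup>2" using r by (rule cg_decrease)
  have \<epsilon>: "0 \<le> l / L" "l / L \<le> 1" using l_pos L_pos l_le_L by simp_all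
  have "(norm (xstar - y (Suc k)))\<^sup>2 \<le> (\<sigma> (Suc k))\<^sup>2 - \<gamma> (Suc k)
    \<and> (\<sigma> (Suc k))\<^sup>2 \<le> (1 - sqrt (l / L)) * (\<sigma> k)\<^sup>2"
  proof (cases "(\<sigma> k)\<^sup>2 \<le> 2 * (\<rho> k)\<^sup>2")
    case True
    define R where "R = 2 * (\<rho> k)\<^sup>2 + 2 * (\<sigma> k)\<^sup>2 - (\<delta> k)\<^sup>2 - ((\<rho> k)\<^sup>2 - (\<sigma> k)\<^sup>2)\<^sup>2 / (\<delta> k)\<^sup>2"
    have \<delta>: "(\<rho> k)\<^sup>2 \<le> (\<delta> k)\<^sup>2" using r by (intro long_step_le_delta) auto
    have diff: "\<bar>(\<rho> k)\<^sup>2 - (\<sigma> k)\<^sup>2\<bar> \<le> (\<delta> k)\<^sup>2"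
      using \<delta> True zero_le_power2[of "\<sigma> k"] by linarith
    have new: "(norm (xstar - y (Suc k)))\<^sup>2 \<le> R / 4 - \<gamma> k"
      unfolding aux_Suc_near(1)[OF True] R_def
      by (rule ball_intersection_enclosed[OF _ diff long_step_ball ball]) (use \<delta> \<rho> in linarith)
    \<comment> \<open>A squared distance is nonnegative. With \<gamma> nonnegative at both indices,
      this clears both absolute values.\<close>
    then have R_ge: "\<gamma> k \<le> R / 4" using zero_le_power2[of "norm (xstar - y (Suc k))"] by linarith
    then have "0 \<le> R" using gamma_nonneg[of k] by linarith
    then have \<sigma>: "(\<sigma> (Suc k))\<^sup>2 = R / 4 - \<gamma> k + \<gamma> (Suc k)"
      using aux_Suc_near(2)[OF True, folded R_def] R_ge gamma_nonneg[of "Suc k"]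
      by (simp only: abs_of_nonneg)
    have "R / 4 - l / L * (\<rho> k)\<^sup>2 \<le> (1 - sqrt (l / L)) * (\<sigma> k)\<^sup>2"
      unfolding R_def using \<rho> \<delta> True \<epsilon> by (intro enclosing_radius_contraction) auto
    then show ?thesis using new \<sigma> dec by linarith
  next
    case False
    have new: "(norm (xstar - y (Suc k)))\<^sup>2 \<le> (\<rho> k)\<^sup>2 - \<gamma> k"
      unfolding aux_Suc_far(1)[OF False] by (rule long_step_ball)
    then have "\<gamma> k \<le> (\<rho> k)\<^sup>2" using zero_le_power2[of "norm (xstar - y (Suc k))"] by linarith
    then have \<sigma>: "(\<sigma> (Suc k))\<^sup>2 = (\<rho> k)\<^sup>2 - \<gamma> k + \<gamma> (Suc k)"
      using aux_Suc_far(2)[OF False] gamma_nonneg[of "Suc k"] by linarith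
    define e where "e = sqrt (l / L)"
    have e: "0 \<le> e" "e \<le> 1" "l / L = e\<^sup>2" using \<epsilon> by (auto simp: e_def)
    \<comment> \<open>Factor \<open>1 - e\<^sup>2 = (1 - e) * (1 + e)\<close>; the bound
      \<open>1 + e \<le> 2\<close> matches the threshold 2 of the case distinction.\<close>
    have "(\<sigma> (Suc k))\<^sup>2 \<le> (1 - e\<^sup>2) * (\<rho> k)\<^sup>2"
      using \<sigma> dec unfolding e(3) by (simp add: left_diff_distrib)
    also have "\<dots> = (1 - e) * ((1 + e) * (\<rho> k)\<^sup>2)"
      by (simp add: algebra_simps power2_eq_square)
    also have "\<dots> \<le> (1 - e) * (2 * (\<rho> k)\<^sup>2)"
      using e \<rho> by (intro mult_left_mono mult_right_mono) auto
    also have "\<dots> \<le> (1 - e) * (\<sigma> k)\<^sup>2"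
      using e False by (intro mult_left_mono) auto
    finally show ?thesis using new \<sigma> unfolding e_def by linarith
  qed
  then show "(norm (xstar - y (Suc k)))\<^sup>2 \<le> (\<sigma> (Suc k))\<^sup>2 - \<gamma> (Suc k)"
    "(\<sigma> (Suc k))\<^sup>2 \<le> (1 - sqrt (l / L)) * (\<sigma> k)\<^sup>2" by blast+
qed

lemma aux_ball:
  assumes "\<And>j. j < k \<Longrightarrow> r j \<noteq> 0"
  shows "(norm (xstar - y k))\<^sup>2 \<le> (\<sigma> k)\<^sup>2 - \<gamma> k"
  using assms
proof (induction k)
  case 0
  then show ?case using initial_ball by (simp add: aux_0 cg_0(1))
next
  case (Suc k)
  then show ?case by (intro aux_step(1)) auto
qed

lemma aux_sigma_contraction:
  assumes "r k \<noteq> 0"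
  shows "(\<sigma> (Suc k))\<^sup>2 \<le> (1 - sqrt (l / L)) * (\<sigma> k)\<^sup>2"
  using residual_nonzero_antimono[OF assms] by (intro aux_step(2) aux_ball) auto

end

theorem theorem9:
  fixes A :: "real^'n^'n" and b x0 xstar :: "real^'n" and l L :: real and k :: nat
  assumes "symmetric_pos_def A"
    and "l \<in> eigenvalues A" and "\<forall>c\<in>eigenvalues A. l \<le> c"
    and "L \<in> eigenvalues A" and "\<forall>c\<in>eigenvalues A. c \<le> L"
    and "is_arg_min (quadratic A b) (\<lambda>_. True) xstar"
    and "k \<ge> 1" and "cg_residual A b x0 (k - 1) \<noteq> 0"
  shows "(aux_sigma (quadratic A b) l xstar (cg_iterate A b x0) k)\<^sup>2
    \<le> (1 - sqrt (l / L)) * (aux_sigma (quadratic A b) l xstar (cg_iterate A b x0) (k - 1))\<^sup>2"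
proof -
  have sym: "transpose A = A" and pos: "\<And>v. v \<noteq> 0 \<Longrightarrow> 0 < v \<bullet> (A *v v)"
    using assms(1) by (auto simp: symmetric_pos_def_def)
  \<comment> \<open>Testing positive definiteness on an eigenvector for \<open>l\<close> yields
    \<open>0 < l\<close>.\<close>
  obtain v where "v \<noteq> 0" "A *v v = l *\<^sub>R v"
    using assms(2) by (auto simp: eigenvalues_def)
  then have "0 < l * (v \<bullet> v)" "0 < v \<bullet> v" using pos[of v] by simp_all
  then have "0 < l" by (rule zero_less_mult_pos2)
  then interpret cg_run A b x0 xstar l L
    using sym eigenvalue_bounds[OF sym assms(3,5)] assms(3,4,6)
    by unfold_locales (auto simp: is_arg_min_linorder)
  \<comment> \<open>\<open>k \<ge> 1\<close> turns \<open>Suc (k - 1)\<close> into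
    \<open>k\<close>.\<close>
  show ?thesis using aux_sigma_contraction[OF assms(8)] assms(7) by simp
qed

end
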